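(* Let $\overline{n}=(n_1,\dots,n_t)\in\mathbb{N}_{>0}^t$ and $\overline{m}=(m_1,\dots,m_t)\in\mathbb{N}^t$ uniquely characterize a simple game $v$ with minimum. If $v$ contains both veto and null players, then $\dim(v)=\max\{t-2,1\}$.
   Context: A simple game is a pair $(N,v)$ with $N$ a finite nonempty set of players and $v:2^N\to\{0,1\}$ satisfying $v(\emptyset)=0$, $v(N)=1$ and $v(S)\le v(T)$ whenever $S\subseteq T$. A coalition $S$ is winning if $v(S)=1$ and losing otherwise; it is minimal winning if it is winning and all its proper subsets are losing. $\mathbb N$ includes $0$. Players $a,b$ are equivalent (equi-desirable) if the transposition of $a$ and $b$ preserves the set of winning coalitions; let $N_1,\dots,N_t$ be the equivalence classes. To a coalition $S$ associate the vector $(|S\cap N_1|,\dots,|S\cap N_t|)$. The vectors of minimal winning coalitions are called minimal winning vectors. A simple game with minimum is a simple game with exactly one minimal winning vector. That $(\overline n,\overline m)$ uniquely characterizes the simple game $v$ with minimum means: $v$ has exactly the $t$ equivalence classes $N_1,\dots,N_t$ with $|N_i|=n_i$, and its unique minimal winning vector is $\overline m$; so $S$ is winning iff $|S\cap N_i|\ge m_i$ for all $i$. A player is null if it belongs to no minimal winning coalition (the players of $N_i$ are null iff $m_i=0$), and veto if it belongs to every winning coalition (the players of $N_i$ are veto iff $m_i=n_i$). A simple game $(N,v)$ is weighted if there are weights $w_i\in\mathbb R$ ($i\in N$) and a quota $q\in\mathbb R$ with $\sum_{i\in W}w_i\ge q>\sum_{i\in L}w_i$ for every winning coalition $W$ and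 every losing coalition $L$. The intersection of simple games on the same player set $N$ is the game in which a coalition is winning iff it is winning in each of them. The dimension $\dim(v)$ is the smallest integer $k\ge1$ such that $v$ is the intersection of $k$ weighted games on $N$. *)

theory Defs
  imports Complex_Main "HOL-Combinatorics.Transposition"
begin

text \<open>
  A game on the player set \<open>N\<close> is given by a function \<open>v\<close> on sets of players, of which only the
  values on subsets of \<open>N\<close> (the coalitions) matter; all notions below quantify over coalitions only.
\<close>

definition simple_game :: "'a set \<Rightarrow> ('a set \<Rightarrow> nat) \<Rightarrow> bool" where
  "simple_game N v \<longleftrightarrow>
     finite N \<and> N \<noteq> {} \<and>
     (\<forall>S. S \<subseteq> N \<longrightarrow> v S \<in> {0, 1}) \<and>
     v {} = 0 \<and> v N = 1 \<and>
     (\<forall>S T. S \<subseteq> T \<and> T \<subseteq> N \<longrightarrow> v S \<le> v T)"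

definition winning :: "'a set \<Rightarrow> ('a set \<Rightarrow> nat) \<Rightarrow> 'a set \<Rightarrow> bool" where
  "winning N v S \<longleftrightarrow> S \<subseteq> N \<and> v S = 1"

definition losing :: "'a set \<Rightarrow> ('a set \<Rightarrow> nat) \<Rightarrow> 'a set \<Rightarrow> bool" where
  "losing N v S \<longleftrightarrow> S \<subseteq> N \<and> v S \<noteq> 1"

definition minimal_winning :: "'a set \<Rightarrow> ('a set \<Rightarrow> nat) \<Rightarrow> 'a set \<Rightarrow> bool" where
  "minimal_winning N v S \<longleftrightarrow> winning N v S \<and> (\<forall>T. T \<subset> S \<longrightarrow> losing N v T)"

definition equi_desirable :: "'a set \<Rightarrow> ('a set \<Rightarrow> nat) \<Rightarrow> ('a \<times> 'a) set" where
  "equi_desirable N v =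
     {(a, b). a \<in> N \<and> b \<in> N \<and>
        (\<forall>S. S \<subseteq> N \<longrightarrow> (winning N v (transpose a b ` S) \<longleftrightarrow> winning N v S))}"

text \<open>
  \<open>Ns\<close> lists the equivalence classes \<open>N\<^sub>1, \<dots>, N\<^sub>t\<close>, each exactly once, in some order; the
  vectors below are lists of length \<open>t\<close> with respect to this order.
\<close>

definition lists_classes :: "'a set \<Rightarrow> ('a set \<Rightarrow> nat) \<Rightarrow> 'a set list \<Rightarrow> bool" where
  "lists_classes N v Ns \<longleftrightarrow> distinct Ns \<and> set Ns = N // equi_desirable N v"

definition coalition_vector :: "'a set list \<Rightarrow> 'a set \<Rightarrow> nat list" where
  "coalition_vector Ns S = map (\<lambda>C. card (S \<inter> C)) Ns"

definition minimal_winning_vectors ::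
    "'a set \<Rightarrow> ('a set \<Rightarrow> nat) \<Rightarrow> 'a set list \<Rightarrow> nat list set" where
  "minimal_winning_vectors N v Ns = coalition_vector Ns ` {S. minimal_winning N v S}"

text \<open>
  The number of minimal winning vectors does not depend on the order of the classes, so it does
  not matter that the order is quantified existentially here.
\<close>

definition simple_game_with_minimum :: "'a set \<Rightarrow> ('a set \<Rightarrow> nat) \<Rightarrow> bool" where
  "simple_game_with_minimum N v \<longleftrightarrow>
     simple_game N v \<and>
     (\<exists>Ns. lists_classes N v Ns \<and> (\<exists>!x. x \<in> minimal_winning_vectors N v Ns))"

text \<open>
  The number of classes is \<open>length n\<close>, because \<open>map card Ns = n\<close>.
\<close>

definition uniquely_characterize ::
    "nat list \<Rightarrow> nat list \<Rightarrow> 'a set \<Rightarrow> ('a set \<Rightarrow> nat) \<Rightarrow> bool" where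
  "uniquely_characterize n m N v \<longleftrightarrow>
     (\<exists>Ns. lists_classes N v Ns \<and> map card Ns = n \<and> minimal_winning_vectors N v Ns = {m})"

definition null_player :: "'a set \<Rightarrow> ('a set \<Rightarrow> nat) \<Rightarrow> 'a \<Rightarrow> bool" where
  "null_player N v p \<longleftrightarrow> p \<in> N \<and> (\<forall>S. minimal_winning N v S \<longrightarrow> p \<notin> S)"

definition veto_player :: "'a set \<Rightarrow> ('a set \<Rightarrow> nat) \<Rightarrow> 'a \<Rightarrow> bool" where
  "veto_player N v p \<longleftrightarrow> p \<in> N \<and> (\<forall>S. winning N v S \<longrightarrow> p \<in> S)"

definition weighted_game :: "'a set \<Rightarrow> ('a set \<Rightarrow> nat) \<Rightarrow> bool" where
  "weighted_game N v \<longleftrightarrow>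
     simple_game N v \<and>
     (\<exists>(w :: 'a \<Rightarrow> real) (q :: real).
        (\<forall>S. winning N v S \<longrightarrow> q \<le> (\<Sum>i\<in>S. w i)) \<and>
        (\<forall>S. losing N v S \<longrightarrow> (\<Sum>i\<in>S. w i) < q))"

definition is_intersection ::
    "'a set \<Rightarrow> ('a set \<Rightarrow> nat) \<Rightarrow> nat \<Rightarrow> (nat \<Rightarrow> 'a set \<Rightarrow> nat) \<Rightarrow> bool" where
  "is_intersection N v k u \<longleftrightarrow>
     (\<forall>S. S \<subseteq> N \<longrightarrow> (winning N v S \<longleftrightarrow> (\<forall>i<k. winning N (u i) S)))"

text \<open>
  Every simple game is an intersection of finitely many weighted games (one for each losing
  coalition \<open>L\<close>: a coalition wins iff it meets \<open>N - L\<close>), so for simple games the minimum exists.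
\<close>

definition dimension :: "'a set \<Rightarrow> ('a set \<Rightarrow> nat) \<Rightarrow> nat" where
  "dimension N v =
     (LEAST k. 1 \<le> k \<and>
        (\<exists>u. (\<forall>i<k. weighted_game N (u i)) \<and> is_intersection N v k u))"

end

theory Submission imports Defs begin

text \<open>
  In a game with minimum, a coalition wins iff it contains at least \<open>r C\<close> players of every class
  \<open>C\<close>, where \<open>r C\<close> is the number of players of \<open>C\<close> in the minimal winning coalitions. Any two veto
  players are equivalent, and so are any two null players; hence there is exactly one class \<open>V\<close> with
  \<open>r V = |V|\<close> and exactly one class \<open>Z\<close> with \<open>r Z = 0\<close>, and the remaining \<open>t - 2\<close> classes are
  non-trivial, in the sense that \<open>0 < r C < |C|\<close>. So the claim is that the dimension is the number of
  non-trivial classes, or 1 if there is none.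

  The upper bound comes from imposing each non-trivial condition \<open>r C \<le> |S \<inter> C|\<close> by a game of its
  own, together with the veto condition \<open>V \<subseteq> S\<close>: a veto condition can be added to a weighted
  condition for free, by giving veto players a large weight
  (\<open>weighted_veto_threshold_game\<close>).

  The lower bound (\<open>nontrivial_classes_le_intersection\<close>) is a trading argument. For a non-trivial
  \<open>C\<close>, the coalition of all players outside \<open>C\<close> and just \<open>r C - 1\<close> players of \<open>C\<close> loses in \<open>v\<close>,
  hence in one of the weighted games with intersection \<open>v\<close>. If one weighted game rejected the
  coalitions of two non-trivial classes, these two coalitions could exchange one player each and
  both become winning, although their total weight would not change. So different non-trivial
  classes need different weighted games.
\<close>

section \<open>Winning coalitions and equivalent players\<close>

lemma winning_superset:
  assumes "simple_game N v" "winning N v S" "S \<subseteq> T" "T \<subseteq> N"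
  shows "winning N v T"
proof -
  have "v S \<le> v T" "v T \<in> {0, 1}" "v S = 1"
    using assms unfolding simple_game_def winning_def by blast+
  then show ?thesis using assms(4) unfolding winning_def by auto
qed

lemma winning_contains_minimal_winning:
  assumes "simple_game N v" "winning N v S"
  shows "\<exists>M\<subseteq>S. minimal_winning N v M"
proof -
  have "finite S"
    using assms unfolding simple_game_def winning_def by (auto intro: finite_subset)
  then have "winning N v S \<Longrightarrow> \<exists>M\<subseteq>S. minimal_winning N v M"
  proof (induction S rule: finite_psubset_induct)
    case (psubset S)
    show ?case
    proof (cases "minimal_winning N v S")
      case False
      then obtain T where "T \<subset> S" "\<not> losing N v T"
        using psubset.prems unfolding minimal_winning_def by auto
      moreover from this have "winning N v T"
        using psubset.prems unfolding winning_def losing_def by auto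
      ultimately obtain M where "M \<subseteq> T" "minimal_winning N v M"
        using psubset.IH[of T] by auto
      then show ?thesis using \<open>T \<subset> S\<close> by (meson psubset_imp_subset subset_trans)
    qed blast
  qed
  then show ?thesis using assms(2) by simp
qed

lemma transpose_image_subset:
  assumes "a \<in> N" "b \<in> N" "S \<subseteq> N"
  shows "transpose a b ` S \<subseteq> N"
  using assms by (auto simp: transpose_def)

lemma transpose_image_exchange:
  assumes "a \<in> S" "b \<notin> S"
  shows "transpose a b ` S = insert b (S - {a})"
  using assms by (auto simp: set_eq_iff in_transpose_image_iff transpose_def)

text \<open>A transposition is an involution, so it suffices that it maps winning coalitions to winning
  coalitions.\<close>

lemma equi_desirableI:
  assumes "a \<in> N" "b \<in> N"
    and "\<And>S. winning N v S \<Longrightarrow> winning N v (transpose a b ` S)"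
  shows "(a, b) \<in> equi_desirable N v"
proof -
  have "winning N v S" if "winning N v (transpose a b ` S)" for S
    using assms(3)[OF that] by (simp add: image_comp)
  then have "winning N v (transpose a b ` S) \<longleftrightarrow> winning N v S" for S
    using assms(3) by (rule iffI)
  then show ?thesis using assms(1,2) unfolding equi_desirable_def by simp
qed

lemma winning_transpose:
  assumes "(a, b) \<in> equi_desirable N v" "winning N v S"
  shows "winning N v (transpose a b ` S)"
proof -
  have "S \<subseteq> N" using assms(2) unfolding winning_def by blast
  then show ?thesis using assms unfolding equi_desirable_def by blast
qed

lemma winning_exchange:
  assumes "(a, b) \<in> equi_desirable N v" "winning N v S" "a \<in> S" "b \<notin> S"
  shows "winning N v (insert b (S - {a}))"
  using winning_transpose[OF assms(1,2)] assms(3,4) by (simp add: transpose_image_exchange)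

text \<open>Transitivity holds since, for \<open>c\<close> different from \<open>a\<close> and \<open>b\<close>, the transposition of \<open>a\<close> and \<open>c\<close>
  is the conjugate of that of \<open>b\<close> and \<open>c\<close> by that of \<open>a\<close> and \<open>b\<close>.\<close>

lemma equiv_equi_desirable: "equiv N (equi_desirable N v)"
proof (rule equivI)
  show "equi_desirable N v \<subseteq> N \<times> N"
    unfolding equi_desirable_def by blast
  show "refl_on N (equi_desirable N v)"
    unfolding equi_desirable_def by (auto simp: refl_on_def)
  show "sym (equi_desirable N v)"
    unfolding equi_desirable_def by (auto simp: sym_def transpose_commute)
  show "trans (equi_desirable N v)"
  proof (rule transI)
    fix a b c
    assume ab: "(a, b) \<in> equi_desirable N v" and bc: "(b, c) \<in> equi_desirable N v"
    show "(a, c) \<in> equi_desirable N v"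
    proof (cases "a = c \<or> b = c")
      case True
      moreover have "(a, a) \<in> equi_desirable N v"
        using ab unfolding equi_desirable_def by simp
      ultimately show ?thesis using ab by blast
    next
      case False
      have N: "a \<in> N" "b \<in> N" "c \<in> N" using ab bc unfolding equi_desirable_def by auto
      show ?thesis
      proof (rule equi_desirableI)
        fix S assume "winning N v S"
        then have "winning N v (transpose a b ` S)"
          by (rule winning_transpose[OF ab])
        then have "winning N v (transpose b c ` transpose a b ` S)"
          by (rule winning_transpose[OF bc])
        then have "winning N v (transpose a b ` transpose b c ` transpose a b ` S)"
          by (rule winning_transpose[OF ab])
        moreover have "transpose a b ` transpose b c ` transpose a b ` S = transpose a c ` S"
          unfolding image_comp using False transpose_comp_triple[of a c b] by (simp add: comp_assoc)
        ultimately show "winning N v (transpose a c ` S)" by simp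
      qed (use N in auto)
    qed
  qed
qed

text \<open>Coalitions without one of two veto players lose, and the others are fixed by the
  transposition.\<close>

lemma veto_players_equi_desirable:
  assumes "veto_player N v a" "veto_player N v b"
  shows "(a, b) \<in> equi_desirable N v"
proof (rule equi_desirableI)
  fix S assume "winning N v S"
  moreover from this have "a \<in> S" "b \<in> S" using assms unfolding veto_player_def by blast+
  ultimately show "winning N v (transpose a b ` S)" by simp
qed (use assms in \<open>auto simp: veto_player_def\<close>)

text \<open>A minimal winning coalition inside \<open>S\<close> avoids both null players, so it survives the
  transposition.\<close>

lemma null_players_equi_desirable:
  assumes game: "simple_game N v" and null: "null_player N v a" "null_player N v b"
  shows "(a, b) \<in> equi_desirable N v"
proof (rule equi_desirableI)
  fix S assume S: "winning N v S"
  then obtain M where M: "M \<subseteq> S" "minimal_winning N v M"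
    using winning_contains_minimal_winning[OF game] by blast
  then have "transpose a b ` M = M"
    using null by (simp add: null_player_def)
  then have "M \<subseteq> transpose a b ` S" using M(1) by blast
  moreover have "transpose a b ` S \<subseteq> N"
    using S null transpose_image_subset[of a N b S] unfolding winning_def null_player_def by blast
  ultimately show "winning N v (transpose a b ` S)"
    using game M(2) unfolding minimal_winning_def by (blast intro: winning_superset)
qed (use null in \<open>auto simp: null_player_def\<close>)

section \<open>Games with minimum as conjunctions of threshold conditions\<close>

text \<open>\<open>r\<close> is the minimal winning vector, indexed by the classes themselves and not by their positions
  in a list.\<close>

locale game_with_minimum =
  fixes N :: "'a set" and v :: "'a set \<Rightarrow> nat" and r :: "'a set \<Rightarrow> nat"
  assumes game: "simple_game N v"
    and profile: "\<And>M C. minimal_winning N v M \<Longrightarrow> C \<in> N // equi_desirable N v \<Longrightarrow> card (M \<inter> C) = r C"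
begin

abbreviation classes :: "'a set set" where
  "classes \<equiv> N // equi_desirable N v"

abbreviation nontrivial_classes :: "'a set set" where
  "nontrivial_classes \<equiv> {C \<in> classes. 0 < r C \<and> r C < card C}"

lemma finite_players: "finite N"
  using game unfolding simple_game_def by blast

lemma winning_grand_coalition: "winning N v N"
  using game unfolding simple_game_def winning_def by blast

lemma class_subset: "C \<in> classes \<Longrightarrow> C \<subseteq> N"
  using equiv_equi_desirable[of N v] by (metis Union_quotient Union_upper)

lemma finite_class: "C \<in> classes \<Longrightarrow> finite C"
  using finite_subset[OF class_subset finite_players] .

lemma class_nonempty: "C \<in> classes \<Longrightarrow> C \<noteq> {}"
  using equiv_equi_desirable[of N v] by (metis in_quotient_imp_non_empty)

lemma finite_classes: "finite classes"
  using finite_quotient[OF finite_players] equiv_equi_desirable[of N v]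
  by (auto simp: equiv_def)

lemma classes_disjoint: "C \<in> classes \<Longrightarrow> D \<in> classes \<Longrightarrow> C \<noteq> D \<Longrightarrow> C \<inter> D = {}"
  using quotient_disj[OF equiv_equi_desirable, of C N v D] by simp

lemma class_of:
  assumes "p \<in> N"
  obtains C where "C \<in> classes" "p \<in> C"
  using assms equiv_equi_desirable[of N v] by (metis UnionE Union_quotient)

lemma equi_desirable_of_class:
  "C \<in> classes \<Longrightarrow> a \<in> C \<Longrightarrow> b \<in> C \<Longrightarrow> (a, b) \<in> equi_desirable N v"
  using equiv_equi_desirable[of N v] by (metis quotient_eq_iff)

lemma class_unique:
  assumes "C \<in> classes" "D \<in> classes" "a \<in> C" "b \<in> D" "(a, b) \<in> equi_desirable N v"
  shows "C = D"
  using quotient_eqI[OF equiv_equi_desirable assms] .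

lemma minimal_winning_exists: obtains M where "minimal_winning N v M"
  using winning_contains_minimal_winning[OF game winning_grand_coalition] by auto

lemma threshold_le_card_class:
  assumes "C \<in> classes" shows "r C \<le> card C"
proof -
  obtain M where "minimal_winning N v M" by (rule minimal_winning_exists)
  then have "r C = card (M \<inter> C)" using profile assms by simp
  then show ?thesis using card_mono[OF finite_class[OF assms], of "M \<inter> C"] by simp
qed

text \<open>Inside a class, a winning coalition can replace a player outside \<open>S\<close> by one of \<open>S\<close> and still
  win. As \<open>S\<close> has enough players in each class, this can go on until the coalition lies in \<open>S\<close>.\<close>

lemma winning_if_dominates_winning:
  assumes S: "S \<subseteq> N"
    and "winning N v M" "\<And>C. C \<in> classes \<Longrightarrow> card (M \<inter> C) \<le> card (S \<inter> C)"
  shows "winning N v S"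
  using assms(2,3)
proof (induction "card (M - S)" arbitrary: M rule: less_induct)
  case less
  have "M \<subseteq> N" using less.prems(1) unfolding winning_def by blast
  then have fin: "finite M" using finite_players by (rule finite_subset)
  show ?case
  proof (cases "M \<subseteq> S")
    case True
    then show ?thesis by (rule winning_superset[OF game less.prems(1) _ S])
  next
    case False
    then obtain a where a: "a \<in> M" "a \<notin> S" by blast
    then obtain C where C: "C \<in> classes" "a \<in> C" using \<open>M \<subseteq> N\<close> class_of[of a] by blast
    have "\<not> S \<inter> C \<subseteq> M \<inter> C"
    proof
      assume "S \<inter> C \<subseteq> M \<inter> C"
      then have "S \<inter> C \<subset> M \<inter> C" using a C by blast
      then have "card (S \<inter> C) < card (M \<inter> C)" using fin by (intro psubset_card_mono) auto
      then show False using less.prems(2)[OF C(1)] by simp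
    qed
    then obtain b where b: "b \<in> S" "b \<in> C" "b \<notin> M" by blast
    define M' where "M' = insert b (M - {a})"
    have win: "winning N v M'"
      unfolding M'_def
      by (rule winning_exchange[OF equi_desirable_of_class[OF C b(2)] less.prems(1) a(1) b(3)])
    have dom: "card (M' \<inter> D) \<le> card (S \<inter> D)" if D: "D \<in> classes" for D
    proof (cases "D = C")
      case True
      have "M' \<inter> C = insert b (M \<inter> C - {a})" using b unfolding M'_def by blast
      then have "card (M' \<inter> C) = Suc (card (M \<inter> C - {a}))" using fin b by simp
      also have "\<dots> = card (M \<inter> C)" using fin a C by (intro card_Suc_Diff1) auto
      finally show ?thesis using less.prems(2)[OF C(1)] True by simp
    next
      case False
      then have "M' \<inter> D = M \<inter> D"
        using classes_disjoint[OF C(1) D False[symmetric]] b C unfolding M'_def by blast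
      then show ?thesis using less.prems(2)[OF D] by simp
    qed
    have "M' - S = M - S - {a}" using b unfolding M'_def by auto
    then have "card (M' - S) < card (M - S)"
      using card_Diff1_less[of "M - S" a] fin a by simp
    then show ?thesis by (rule less.hyps[OF _ win dom])
  qed
qed

lemma winning_iff_thresholds:
  assumes "S \<subseteq> N"
  shows "winning N v S \<longleftrightarrow> (\<forall>C\<in>classes. r C \<le> card (S \<inter> C))"
proof
  assume "winning N v S"
  then obtain M where M: "M \<subseteq> S" "minimal_winning N v M"
    using winning_contains_minimal_winning[OF game] by blast
  show "\<forall>C\<in>classes. r C \<le> card (S \<inter> C)"
  proof
    fix C assume C: "C \<in> classes"
    have "card (M \<inter> C) \<le> card (S \<inter> C)"
      using M finite_class[OF C] by (intro card_mono) auto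
    then show "r C \<le> card (S \<inter> C)" using profile M C by simp
  qed
next
  assume *: "\<forall>C\<in>classes. r C \<le> card (S \<inter> C)"
  obtain M where M: "minimal_winning N v M" by (rule minimal_winning_exists)
  then have "winning N v M" unfolding minimal_winning_def by blast
  then show "winning N v S"
    using winning_if_dominates_winning[OF assms, of M] * profile[OF M] by simp
qed

section \<open>The veto class and the null class\<close>

lemma veto_iff_full_threshold:
  assumes C: "C \<in> classes" and p: "p \<in> C"
  shows "veto_player N v p \<longleftrightarrow> r C = card C"
proof
  assume veto: "veto_player N v p"
  obtain M where M: "minimal_winning N v M" by (rule minimal_winning_exists)
  then have win: "winning N v M" unfolding minimal_winning_def by blast
  have "C \<subseteq> M"
  proof
    fix q assume q: "q \<in> C"
    show "q \<in> M"
    proof (rule ccontr)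
      assume "q \<notin> M"
      moreover have "p \<in> M" using veto win unfolding veto_player_def by blast
      \<comment> \<open>Otherwise exchanging \<open>p\<close> for \<open>q\<close> gives a winning coalition without the veto player.\<close>
      ultimately have "winning N v (insert q (M - {p}))"
        using winning_exchange[OF equi_desirable_of_class[OF C p q] win] by blast
      then show False using veto \<open>p \<in> M\<close> \<open>q \<notin> M\<close> unfolding veto_player_def by blast
    qed
  qed
  then show "r C = card C" using profile[OF M C] by (simp add: Int_absorb1)
next
  assume full: "r C = card C"
  have "p \<in> S" if "winning N v S" for S
  proof -
    have "card C \<le> card (S \<inter> C)"
      using that full C winning_iff_thresholds[of S] unfolding winning_def by auto
    then have "S \<inter> C = C" using finite_class[OF C] by (intro card_seteq) auto
    then show ?thesis using p by blast
  qed
  then show "veto_player N v p" using class_subset[OF C] p unfolding veto_player_def by blast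
qed

lemma null_iff_zero_threshold:
  assumes C: "C \<in> classes" and p: "p \<in> C"
  shows "null_player N v p \<longleftrightarrow> r C = 0"
proof
  assume null: "null_player N v p"
  obtain M where M: "minimal_winning N v M" by (rule minimal_winning_exists)
  then have win: "winning N v M" unfolding minimal_winning_def by blast
  have pM: "p \<notin> M" using null M unfolding null_player_def by blast
  show "r C = 0"
  proof (rule ccontr)
    assume "r C \<noteq> 0"
    then have "M \<inter> C \<noteq> {}" using profile[OF M C] by auto
    then obtain q where q: "q \<in> M" "q \<in> C" by blast
    define M' where "M' = insert p (M - {q})"
    have "winning N v M'"
      unfolding M'_def using winning_exchange[OF equi_desirable_of_class[OF C q(2) p] win] q pM by blast
    then obtain T where T: "T \<subseteq> M'" "minimal_winning N v T"
      using winning_contains_minimal_winning[OF game] by blast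
    \<comment> \<open>\<open>T\<close> needs as many players of \<open>C\<close> as \<open>M\<close> has, but \<open>M'\<close> without \<open>p\<close> has one fewer.\<close>
    have "p \<notin> T" using null T unfolding null_player_def by blast
    then have "T \<inter> C \<subset> M \<inter> C" using T(1) q unfolding M'_def by blast
    then have "card (T \<inter> C) < card (M \<inter> C)"
      using finite_class[OF C] by (intro psubset_card_mono) auto
    then show False using profile[OF M C] profile[OF T(2) C] by simp
  qed
next
  assume zero: "r C = 0"
  have "p \<notin> M" if "minimal_winning N v M" for M
    using profile[OF that C] zero p finite_class[OF C] by auto
  then show "null_player N v p" using class_subset[OF C] p unfolding null_player_def by blast
qed

lemma veto_class_unique:
  assumes "C \<in> classes" "D \<in> classes" "r C = card C" "r D = card D"
  shows "C = D"
proof -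
  obtain a b where "a \<in> C" "b \<in> D"
    using class_nonempty[OF assms(1)] class_nonempty[OF assms(2)] by auto
  then show ?thesis
    using assms class_unique veto_players_equi_desirable veto_iff_full_threshold by metis
qed

lemma null_class_unique:
  assumes "C \<in> classes" "D \<in> classes" "r C = 0" "r D = 0"
  shows "C = D"
proof -
  obtain a b where "a \<in> C" "b \<in> D"
    using class_nonempty[OF assms(1)] class_nonempty[OF assms(2)] by auto
  then show ?thesis
    using assms class_unique null_players_equi_desirable[OF game] null_iff_zero_threshold by metis
qed

lemma classes_decomposition:
  assumes "\<exists>p. veto_player N v p" and "\<exists>p. null_player N v p"
  obtains V Z where "V \<in> classes" "r V = card V" "r Z = 0"
    "classes = insert V (insert Z nontrivial_classes)"
    "card classes = card nontrivial_classes + 2"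
proof -
  obtain p q where p: "veto_player N v p" and q: "null_player N v q" using assms by blast
  obtain V where V: "V \<in> classes" "p \<in> V" using p class_of unfolding veto_player_def by blast
  obtain Z where Z: "Z \<in> classes" "q \<in> Z" using q class_of unfolding null_player_def by blast
  have full: "r V = card V" using veto_iff_full_threshold[OF V] p by simp
  have zero: "r Z = 0" using null_iff_zero_threshold[OF Z] q by simp
  have "V \<noteq> Z" using full zero class_nonempty[OF V(1)] finite_class[OF V(1)] by auto
  have eq: "classes = insert V (insert Z nontrivial_classes)"
  proof (intro equalityI subsetI)
    fix C assume C: "C \<in> classes"
    have "C = V" if "r C = card C" using veto_class_unique[OF C V(1) that full] .
    moreover have "C = Z" if "r C = 0" using null_class_unique[OF C Z(1) that zero] .
    ultimately show "C \<in> insert V (insert Z nontrivial_classes)"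
      using C threshold_le_card_class[OF C] by (auto simp: le_less)
  qed (use V Z in auto)
  have "finite nontrivial_classes" using finite_classes by simp
  then have "card (insert V (insert Z nontrivial_classes)) = card nontrivial_classes + 2"
    using \<open>V \<noteq> Z\<close> full zero by (simp add: card_insert_if)
  then have "card classes = card nontrivial_classes + 2" by (metis eq)
  then show thesis using that V full zero eq by blast
qed

section \<open>Lower bound on the dimension\<close>

text \<open>The coalitions \<open>L C\<close> and \<open>L D\<close> are those of the trading argument: they contain everybody outside
  their own class and all but one of the players required from it.\<close>

lemma nontrivial_classes_le_intersection:
  assumes weighted: "\<And>i. i < k \<Longrightarrow> weighted_game N (u i)" and inter: "is_intersection N v k u"
  shows "card nontrivial_classes \<le> k"
proof -
  have "\<exists>A\<subseteq>C. card A = r C - 1" if "C \<in> nontrivial_classes" for C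
  proof -
    have "r C - 1 \<le> card C" using that by auto
    then show ?thesis by (metis obtain_subset_with_card_n)
  qed
  then obtain A where A: "\<And>C. C \<in> nontrivial_classes \<Longrightarrow> A C \<subseteq> C \<and> card (A C) = r C - 1"
    by metis
  define L where "L C = N - C \<union> A C" for C
  have L_subset: "L C \<subseteq> N" if "C \<in> nontrivial_classes" for C
    using A[OF that] class_subset that unfolding L_def by blast
  have "\<exists>i<k. losing N (u i) (L C)" if C: "C \<in> nontrivial_classes" for C
  proof -
    have "L C \<inter> C = A C" using A[OF C] unfolding L_def by blast
    then have "card (L C \<inter> C) < r C" using A[OF C] C by auto
    then have "\<not> winning N v (L C)"
      using winning_iff_thresholds[OF L_subset[OF C]] C by auto
    then show ?thesis
      using inter L_subset[OF C] unfolding is_intersection_def losing_def winning_def by auto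
  qed
  then obtain f where f: "\<And>C. C \<in> nontrivial_classes \<Longrightarrow> f C < k \<and> losing N (u (f C)) (L C)"
    by metis
  have trade: "winning N v (insert a (L C - {b}))"
    if C: "C \<in> nontrivial_classes" and D: "D \<in> nontrivial_classes" and "C \<noteq> D"
      and a: "a \<in> C - A C" and b: "b \<in> D - A D" for C D a b
  proof -
    let ?W = "insert a (L C - {b})"
    have cC: "C \<in> classes" and cD: "D \<in> classes" using C D by auto
    have disj: "C \<inter> D = {}" using classes_disjoint[OF cC cD \<open>C \<noteq> D\<close>] .
    have sub: "?W \<subseteq> N" using L_subset[OF C] a class_subset[OF cC] by blast
    have "r E \<le> card (?W \<inter> E)" if E: "E \<in> classes" for E
    proof -
      consider "E = C" | "E = D" | "E \<noteq> C" "E \<noteq> D" by blast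
      then show ?thesis
      proof cases
        case 1
        have "?W \<inter> C = insert a (A C)" using A[OF C] a b disj unfolding L_def by blast
        moreover have "finite (A C)" using A[OF C] finite_class[OF cC] finite_subset by blast
        ultimately have "card (?W \<inter> C) = r C" using A[OF C] a C by simp
        then show ?thesis using 1 by simp
      next
        case 2
        have "?W \<inter> D = D - {b}"
          using A[OF C] a disj class_subset[OF cD] unfolding L_def by blast
        then have "card (?W \<inter> D) = card D - 1" using b by simp
        then show ?thesis using 2 D by auto
      next
        case 3
        have "?W \<inter> E = E"
          using classes_disjoint[OF cC E] classes_disjoint[OF cD E] 3 b class_subset[OF E]
          unfolding L_def by blast
        then show ?thesis using threshold_le_card_class[OF E] by simp
      qed
    qed
    then show ?thesis using winning_iff_thresholds[OF sub] by blast
  qed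
  have outside: "\<exists>a. a \<in> C - A C" if C: "C \<in> nontrivial_classes" for C
  proof -
    have "card (A C) < card C" using A[OF C] C by auto
    then have "A C \<noteq> C" by auto
    then show ?thesis using A[OF C] by blast
  qed
  have "inj_on f nontrivial_classes"
  proof (rule inj_onI, rule ccontr)
    fix C D
    assume C: "C \<in> nontrivial_classes" and D: "D \<in> nontrivial_classes"
      and same: "f C = f D" and "C \<noteq> D"
    obtain a b where a: "a \<in> C - A C" and b: "b \<in> D - A D" using outside C D by blast
    have disj: "C \<inter> D = {}" using classes_disjoint C D \<open>C \<noteq> D\<close> by blast
    have fin: "finite (L C)" "finite (L D)"
      using L_subset C D finite_players finite_subset by blast+
    obtain w :: "'a \<Rightarrow> real" and q where
      win: "\<And>S. winning N (u (f C)) S \<Longrightarrow> q \<le> sum w S" and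
      lose: "\<And>S. losing N (u (f C)) S \<Longrightarrow> sum w S < q"
      using weighted f[OF C] unfolding weighted_game_def by blast
    have win_u: "winning N (u (f C)) S" if "winning N v S" for S
      using that inter f[OF C] unfolding is_intersection_def winning_def by blast
    have swap: "sum w (insert x (S - {y})) = sum w S + w x - w y"
      if "finite S" "y \<in> S" "x \<notin> S" for S x y
      using that by (simp add: sum_diff1)
    have "a \<in> N" "b \<in> N" using a b C D class_subset by blast+
    then have mem: "b \<in> L C" "a \<notin> L C" "a \<in> L D" "b \<notin> L D"
      using a b disj unfolding L_def by blast+
    have "q \<le> sum w (L C) + w a - w b"
      using win[OF win_u[OF trade[OF C D \<open>C \<noteq> D\<close> a b]]] swap[OF fin(1) mem(1,2)] by simp
    moreover have "q \<le> sum w (L D) + w b - w a"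
      using win[OF win_u[OF trade[OF D C \<open>C \<noteq> D\<close>[symmetric] b a]]] swap[OF fin(2) mem(3,4)] by simp
    moreover have "sum w (L C) < q" "sum w (L D) < q"
      using lose f[OF C] f[OF D] same by auto
    ultimately show False by linarith
  qed
  moreover have "f ` nontrivial_classes \<subseteq> {..<k}" using f by blast
  ultimately show ?thesis using card_inj_on_le[of f nontrivial_classes "{..<k}"] by simp
qed

end

section \<open>Upper bound on the dimension\<close>

definition veto_threshold_game :: "'a set \<Rightarrow> 'a set \<Rightarrow> nat \<Rightarrow> 'a set \<Rightarrow> nat" where
  "veto_threshold_game V C r S = (if V \<subseteq> S \<and> r \<le> card (S \<inter> C) then 1 else 0)"

lemma winning_veto_threshold_game:
  "winning N (veto_threshold_game V C r) S \<longleftrightarrow> S \<subseteq> N \<and> V \<subseteq> S \<and> r \<le> card (S \<inter> C)"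
  unfolding winning_def veto_threshold_game_def by auto

text \<open>Players of \<open>C\<close> get weight 1. A player of \<open>V\<close> weighs more than all of \<open>C\<close>, so that a missing
  veto player cannot be compensated.\<close>

lemma weighted_veto_threshold_game:
  assumes N: "finite N" and V: "V \<subseteq> N" "V \<noteq> {}" and C: "C \<subseteq> N" "V \<inter> C = {}" "r \<le> card C"
  shows "weighted_game N (veto_threshold_game V C r)"
  unfolding weighted_game_def
proof (intro conjI exI allI impI)
  have fin: "finite V" "finite C" using N V C finite_subset by blast+
  show "simple_game N (veto_threshold_game V C r)"
    unfolding simple_game_def
  proof (intro conjI allI impI)
    show "N \<noteq> {}" using V by blast
    show "veto_threshold_game V C r {} = 0" using V(2) by (simp add: veto_threshold_game_def)
    show "veto_threshold_game V C r N = 1"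
      using V(1) C by (simp add: veto_threshold_game_def Int_absorb1)
    show "veto_threshold_game V C r S \<in> {0, 1}" for S by (simp add: veto_threshold_game_def)
    fix S T assume ST: "S \<subseteq> T \<and> T \<subseteq> N"
    then have "card (S \<inter> C) \<le> card (T \<inter> C)" using fin by (intro card_mono) auto
    then show "veto_threshold_game V C r S \<le> veto_threshold_game V C r T"
      using ST by (auto simp: veto_threshold_game_def)
  qed (rule N)
  define B where "B = card C + 1"
  define w :: "'a \<Rightarrow> real" where "w i = of_bool (i \<in> V) * real B + of_bool (i \<in> C)" for i
  have w_sum: "sum w S = real (card (S \<inter> V) * B + card (S \<inter> C))" if "S \<subseteq> N" for S
  proof -
    have "finite S" using that N finite_subset by blast
    then have "(\<Sum>i\<in>S. of_bool (i \<in> X)) = real (card (S \<inter> X))" for X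
      by (simp add: Int_def)
    then show ?thesis by (simp add: w_def sum.distrib flip: sum_distrib_right)
  qed
  show "real (card V * B + r) \<le> sum w S" if "winning N (veto_threshold_game V C r) S" for S
    using that w_sum[of S] by (simp add: winning_veto_threshold_game Int_absorb1)
  show "sum w S < real (card V * B + r)" if lose: "losing N (veto_threshold_game V C r) S" for S
  proof -
    have S: "S \<subseteq> N" using lose unfolding losing_def by blast
    have "card (S \<inter> V) * B + card (S \<inter> C) < card V * B + r"
    proof (cases "V \<subseteq> S")
      case True
      then have "card (S \<inter> C) < r"
        using lose unfolding losing_def veto_threshold_game_def by (auto split: if_splits)
      then show ?thesis using True by (simp add: Int_absorb1)
    next
      case False
      then have "S \<inter> V \<subset> V" by blast
      then have "Suc (card (S \<inter> V)) \<le> card V" using psubset_card_mono[OF fin(1)] by (intro Suc_leI)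
      then have "Suc (card (S \<inter> V)) * B \<le> card V * B" by (rule mult_le_mono1)
      moreover have "card (S \<inter> C) < B"
        unfolding B_def using card_mono[OF fin(2), of "S \<inter> C"] by simp
      ultimately show ?thesis by simp
    qed
    then show ?thesis unfolding w_sum[OF S] of_nat_less_iff .
  qed
qed

lemma (in game_with_minimum) intersection_of_veto_threshold_games:
  assumes V: "V \<in> classes" "r V = card V" and Z: "r Z = 0"
    and decomp: "classes = insert V (insert Z nontrivial_classes)"
  shows "\<exists>u. (\<forall>i<max 1 (card nontrivial_classes). weighted_game N (u i)) \<and>
    is_intersection N v (max 1 (card nontrivial_classes)) u"
proof -
  let ?k = "max 1 (card nontrivial_classes)"
  have V': "V \<subseteq> N" "V \<noteq> {}" using V class_subset class_nonempty by blast+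
  have full: "r V \<le> card (S \<inter> V) \<longleftrightarrow> V \<subseteq> S" for S
    using V(2) card_seteq[OF finite_class[OF V(1)], of "S \<inter> V"]
    by (auto simp: Int_absorb1)
  have win: "winning N v S \<longleftrightarrow> V \<subseteq> S \<and> (\<forall>C\<in>nontrivial_classes. r C \<le> card (S \<inter> C))"
    if "S \<subseteq> N" for S
    unfolding winning_iff_thresholds[OF that] by (subst decomp) (simp add: full Z)
  have fin: "finite nontrivial_classes" using finite_classes by simp
  show ?thesis
  proof (cases "nontrivial_classes = {}")
    case True
    \<comment> \<open>The veto condition alone is the case of an empty class with threshold 0.\<close>
    let ?u = "\<lambda>i::nat. veto_threshold_game V {} 0"
    have "\<forall>i<?k. weighted_game N (?u i)"
      using weighted_veto_threshold_game[OF finite_players V', of "{}" 0] by simp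
    moreover have "is_intersection N v ?k ?u"
      unfolding is_intersection_def
    proof (intro allI impI)
      fix S assume S: "S \<subseteq> N"
      have "winning N v S \<longleftrightarrow> V \<subseteq> S" unfolding win[OF S] True by simp
      moreover have "0 < ?k" by simp
      ultimately show "winning N v S \<longleftrightarrow> (\<forall>i<?k. winning N (?u i) S)"
        using S unfolding winning_veto_threshold_game by auto
    qed
    ultimately show ?thesis by (intro exI[of _ ?u] conjI)
  next
    case False
    then have "0 < card nontrivial_classes" by (intro card_gt_0_iff[THEN iffD2] conjI fin)
    then have k: "?k = card nontrivial_classes" by linarith
    obtain g where g: "bij_betw g {..<card nontrivial_classes} nontrivial_classes"
      using ex_bij_betw_nat_finite[OF fin] unfolding atLeast0LessThan by blast
    then have img: "g ` {..<card nontrivial_classes} = nontrivial_classes"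
      by (rule bij_betw_imp_surj_on)
    let ?u = "\<lambda>i. veto_threshold_game V (g i) (r (g i))"
    have "\<forall>i<?k. weighted_game N (?u i)"
    proof (intro allI impI)
      fix i assume i: "i < ?k"
      have gi: "g i \<in> nontrivial_classes" using img i k by auto
      then have "V \<noteq> g i" using V(2) by auto
      then have "V \<inter> g i = {}" using gi V(1) classes_disjoint by blast
      then show "weighted_game N (?u i)"
        using weighted_veto_threshold_game[OF finite_players V'] gi class_subset by auto
    qed
    moreover have "is_intersection N v ?k ?u"
      unfolding is_intersection_def
    proof (intro allI impI)
      fix S assume S: "S \<subseteq> N"
      have "(\<forall>C\<in>nontrivial_classes. r C \<le> card (S \<inter> C)) \<longleftrightarrow> (\<forall>i<?k. r (g i) \<le> card (S \<inter> g i))"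
        unfolding k by (subst img[symmetric]) blast
      moreover have "0 < ?k" by simp
      ultimately show "winning N v S \<longleftrightarrow> (\<forall>i<?k. winning N (?u i) S)"
        using S win[OF S] unfolding winning_veto_threshold_game by blast
    qed
    ultimately show ?thesis by (intro exI[of _ ?u] conjI)
  qed
qed

section \<open>The dimension\<close>

theorem corollary4p4:
  fixes N :: "'a set" and v :: "'a set \<Rightarrow> nat"
    and t :: nat and n m :: "nat list"
  assumes "length n = t" and "length m = t"
    and "\<forall>i<t. 0 < n ! i"
    and "simple_game_with_minimum N v"
    and "uniquely_characterize n m N v"
    and "\<exists>p. veto_player N v p"
    and "\<exists>p. null_player N v p"
  shows "int (dimension N v) = max (int t - 2) 1"
proof -
  have game: "simple_game N v" using assms(4) unfolding simple_game_with_minimum_def by (rule conjunct1)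
  obtain Ns where Ns: "lists_classes N v Ns" "map card Ns = n"
    and vectors: "minimal_winning_vectors N v Ns = {m}"
    using assms(5) unfolding uniquely_characterize_def by blast
  have set_Ns: "distinct Ns" "set Ns = N // equi_desirable N v"
    using Ns(1) unfolding lists_classes_def by auto
  have t: "card (N // equi_desirable N v) = t"
    using set_Ns Ns(2) assms(1) distinct_card[of Ns] by auto
  have vector: "map (\<lambda>C. card (M \<inter> C)) Ns = m" if "minimal_winning N v M" for M
    using that vectors unfolding minimal_winning_vectors_def coalition_vector_def by blast
  have "m \<in> minimal_winning_vectors N v Ns" using vectors by simp
  then obtain M where M: "minimal_winning N v M"
    unfolding minimal_winning_vectors_def by blast
  define r where "r C = card (M \<inter> C)" for C
  interpret game_with_minimum N v r
  proof
    fix M' C assume "minimal_winning N v M'" "C \<in> N // equi_desirable N v"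
    then show "card (M' \<inter> C) = r C"
      using vector[of M'] vector[OF M] set_Ns unfolding r_def by (auto simp: map_eq_conv)
  qed (rule game)
  obtain V Z where V: "V \<in> classes" "r V = card V" "r Z = 0"
    and decomp: "classes = insert V (insert Z nontrivial_classes)"
    and card: "card classes = card nontrivial_classes + 2"
    by (rule classes_decomposition[OF assms(6,7)])
  have "dimension N v = max 1 (card nontrivial_classes)"
    unfolding dimension_def
  proof (rule Least_equality)
    show "1 \<le> max 1 (card nontrivial_classes) \<and>
      (\<exists>u. (\<forall>i<max 1 (card nontrivial_classes). weighted_game N (u i)) \<and>
        is_intersection N v (max 1 (card nontrivial_classes)) u)"
      using intersection_of_veto_threshold_games[OF V decomp] by simp
  next
    fix k
    assume "1 \<le> k \<and> (\<exists>u. (\<forall>i<k. weighted_game N (u i)) \<and> is_intersection N v k u)"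
    then show "max 1 (card nontrivial_classes) \<le> k"
      using nontrivial_classes_le_intersection by auto
  qed
  then show ?thesis using card t by auto
qed

end
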